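(* A $c$-competitive online algorithm for Online Sum-Radii Clustering in HSTs with $K+1$ levels implies a $c$-competitive online algorithm for the interval version of Parking Permit with $K$ permit types.
   Context: Online Sum-Radii Clustering (OnlSumRad): given a metric space $(M,d)$ and opening cost $f>0$, demand points $u_1,\dots,u_n\in M$ arrive one by one; upon arrival of $u_j$, if $u_j$ is not contained in an already opened cluster, the algorithm must irrevocably open a new cluster $C(p,r)=\{v\in M: d(p,v)\le r\}$ containing $u_j$ (fixing $p$ and $r$) at cost $f+r$. The algorithm is $c$-competitive if on every demand sequence its total cost is at most $c$ times the minimum offline cost $\sum_i(f+r_i)$ of a collection of clusters covering all demands. For $\alpha>1$, an $\alpha$-HST (hierarchically $\alpha$-well-separated tree) is a complete rooted tree with edge lengths such that (i) the edge length from any node to each of its children is the same, and (ii) the edge lengths along any root-to-leaf path decrease by a factor of at least $\alpha$ on each level; it induces the shortest-path metric on its nodes. Leaves are at level $0$, and an HST with $K+1$ levels has levels $0,\dots,K$. Parking Permit, interval version, with $K$ permit types: there is a schedule of days; a permit of type $k\in\{1,\dots,K\}$ has cost $c_k$ and duration $d_k$; permits are available only over fixed intervals, every day is covered by exactly one permit of each type, each permit of type $k\ge 2$ is partitioned into exactly $d_k/d_{k-1}$ (an integer) permits of type $k-1$, and $c_k\ge 2c_{k-1}$, $d_k\ge d_{k-1}$ for $1<k\le K$. Driving days are revealed online one by one, and the algorithm irrevocably purchases permits so that every revealed driving day is covered by a purchased permit; it is $c$-competitive if its total cost is always at most $c$ times the minimum total cost of a set of permits covering all driving days. *)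

theory Defs
  imports "HOL-Analysis.Analysis" "HOL-Library.Disjoint_Sets" "Graph_Theory.Graph_Theory"
begin

section \<open>Online Sum-Radii Clustering\<close>

text \<open>A pair \<open>(p, r)\<close> denotes the cluster \<open>C(p, r)\<close> with centre \<open>p\<close> and radius \<open>r\<close>.\<close>

type_synonym 'a cluster = "'a \<times> real"

definition is_cluster :: "'a set \<Rightarrow> 'a cluster \<Rightarrow> bool" where
  "is_cluster M C \<longleftrightarrow> fst C \<in> M \<and> 0 \<le> snd C"

definition cluster_points :: "'a set \<Rightarrow> ('a \<Rightarrow> 'a \<Rightarrow> real) \<Rightarrow> 'a cluster \<Rightarrow> 'a set" where
  "cluster_points M d C = {v \<in> M. d (fst C) v \<le> snd C}"

definition covered :: "'a set \<Rightarrow> ('a \<Rightarrow> 'a \<Rightarrow> real) \<Rightarrow> 'a cluster list \<Rightarrow> 'a set" where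
  "covered M d Cs = (\<Union>C\<in>set Cs. cluster_points M d C)"

definition clusters_cost :: "real \<Rightarrow> 'a cluster list \<Rightarrow> real" where
  "clusters_cost f Cs = (\<Sum>C\<leftarrow>Cs. f + snd C)"

definition sum_radii_opt :: "'a set \<Rightarrow> ('a \<Rightarrow> 'a \<Rightarrow> real) \<Rightarrow> real \<Rightarrow> 'a list \<Rightarrow> real" where
  "sum_radii_opt M d f us =
     Inf {clusters_cost f Cs |Cs. (\<forall>C\<in>set Cs. is_cluster M C) \<and> set us \<subseteq> covered M d Cs}"

text \<open>
  A deterministic online algorithm maps the demands \<open>u\<^sub>1, \<dots>, u\<^sub>j\<close> revealed so far to the
  cluster that it opens if \<open>u\<^sub>j\<close> is not yet covered; its answer is ignored otherwise.
\<close>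

type_synonym 'a sum_radii_alg = "'a list \<Rightarrow> 'a cluster"

primrec opened ::
  "'a set \<Rightarrow> ('a \<Rightarrow> 'a \<Rightarrow> real) \<Rightarrow> 'a sum_radii_alg \<Rightarrow> 'a list \<Rightarrow> nat \<Rightarrow> 'a cluster list" where
  "opened M d A us 0 = []"
| "opened M d A us (Suc j) =
     (let Cs = opened M d A us j in
      if us ! j \<in> covered M d Cs then Cs else Cs @ [A (take (Suc j) us)])"

definition sum_radii_feasible ::
  "'a set \<Rightarrow> ('a \<Rightarrow> 'a \<Rightarrow> real) \<Rightarrow> 'a sum_radii_alg \<Rightarrow> bool" where
  "sum_radii_feasible M d A \<longleftrightarrow>
     (\<forall>us\<in>lists M. \<forall>j<length us. us ! j \<notin> covered M d (opened M d A us j) \<longrightarrow>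
        is_cluster M (A (take (Suc j) us)) \<and> us ! j \<in> cluster_points M d (A (take (Suc j) us)))"

definition sum_radii_competitive ::
  "real \<Rightarrow> 'a set \<Rightarrow> ('a \<Rightarrow> 'a \<Rightarrow> real) \<Rightarrow> real \<Rightarrow> 'a sum_radii_alg \<Rightarrow> bool" where
  "sum_radii_competitive c M d f A \<longleftrightarrow>
     sum_radii_feasible M d A \<and>
     (\<forall>us\<in>lists M. clusters_cost f (opened M d A us (length us)) \<le> c * sum_radii_opt M d f us)"


section \<open>Hierarchically well-separated trees\<close>

text \<open>
  A finite rooted tree is given by its nodes, its root and the parent of every other node.
  \<open>edge_len T v\<close> is the length of the edge between \<open>v \<noteq> hst_root T\<close> and its parent. The fields
  \<open>parent\<close> and \<open>edge_len\<close> are irrelevant at the root and outside \<open>nodes T\<close>. Since trees are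
  finite, it is no restriction that nodes are natural numbers.
\<close>

record hst =
  nodes :: "nat set"
  hst_root :: nat
  parent :: "nat \<Rightarrow> nat"
  level :: "nat \<Rightarrow> nat"
  edge_len :: "nat \<Rightarrow> real"

definition children :: "hst \<Rightarrow> nat \<Rightarrow> nat set" where
  "children T v = {u \<in> nodes T - {hst_root T}. parent T u = v}"

text \<open>
  Going to the parent raises the level by one and the root is on level \<open>K\<close>, so the parent
  relation is acyclic and leads to the root, and \<open>K - level T v\<close> is the depth of \<open>v\<close>.
  Completeness of the tree means that all leaves have the same depth, i.e. are on level 0.
  Nodes need not have the same number of children, and a node may have a single child.
\<close>

definition complete_rooted_tree :: "nat \<Rightarrow> hst \<Rightarrow> bool" where
  "complete_rooted_tree K T \<longleftrightarrow>
     finite (nodes T) \<and> hst_root T \<in> nodes T \<and> level T (hst_root T) = K \<and>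
     (\<forall>v\<in>nodes T - {hst_root T}. parent T v \<in> nodes T \<and> level T (parent T v) = Suc (level T v)) \<and>
     (\<forall>v\<in>nodes T. children T v = {} \<longrightarrow> level T v = 0)"

definition is_hst :: "real \<Rightarrow> nat \<Rightarrow> hst \<Rightarrow> bool" where
  "is_hst \<alpha> K T \<longleftrightarrow>
     complete_rooted_tree K T \<and>
     (\<forall>v\<in>nodes T - {hst_root T}. 0 < edge_len T v) \<and>
     (\<forall>v\<in>nodes T. \<forall>u\<in>children T v. \<forall>u'\<in>children T v. edge_len T u = edge_len T u') \<and>
     (\<forall>v\<in>nodes T - {hst_root T}. \<forall>u\<in>children T v. \<alpha> * edge_len T u \<le> edge_len T v)"

definition tree_graph :: "hst \<Rightarrow> (nat, nat \<times> nat) pre_digraph" where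
  "tree_graph T = \<lparr>verts = nodes T,
     arcs = (\<Union>v\<in>nodes T - {hst_root T}. {(v, parent T v), (parent T v, v)}),
     tail = fst, head = snd\<rparr>"

definition arc_len :: "hst \<Rightarrow> nat \<times> nat \<Rightarrow> real" where
  "arc_len T = (\<lambda>(u, v). if u \<noteq> hst_root T \<and> parent T u = v then edge_len T u else edge_len T v)"

definition tree_dist :: "hst \<Rightarrow> nat \<Rightarrow> nat \<Rightarrow> real" where
  "tree_dist T u v = real_of_ereal (wf_digraph.\<mu> (tree_graph T) (arc_len T) u v)"

text \<open>The shortest-path distance of an HST is a metric on its nodes.\<close>

lemma tree_graph_simps [simp]:
  "verts (tree_graph T) = nodes T" "tail (tree_graph T) = fst" "head (tree_graph T) = snd"
  by (simp_all add: tree_graph_def)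

lemma arcs_tree_graph:
  "arcs (tree_graph T) = (\<Union>v\<in>nodes T - {hst_root T}. {(v, parent T v), (parent T v, v)})"
  by (simp add: tree_graph_def)

lemma fin_digraph_tree_graph:
  assumes "complete_rooted_tree K T"
  shows "fin_digraph (tree_graph T)"
  using assms by unfold_locales (auto simp: arcs_tree_graph complete_rooted_tree_def)

lemma tree_reaches_root:
  assumes T: "complete_rooted_tree K T" and "v \<in> nodes T"
  shows "\<exists>p. pre_digraph.awalk (tree_graph T) v p (hst_root T)"
proof -
  interpret fin_digraph "tree_graph T" by (rule fin_digraph_tree_graph[OF T])
  have fin: "finite (level T ` nodes T)" using T by (simp add: complete_rooted_tree_def)
  show ?thesis using assms(2)
  proof (induction "Max (level T ` nodes T) - level T v" arbitrary: v rule: less_induct)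
    case less
    show ?case
    proof (cases "v = hst_root T")
      case True
      then show ?thesis using less.prems
        by (intro exI[of _ "[]"]) (simp add: awalk_Nil_iff)
    next
      case False
      let ?u = "parent T v"
      have u: "?u \<in> nodes T" "level T ?u = Suc (level T v)"
        using T False less.prems by (auto simp: complete_rooted_tree_def)
      have "level T ?u \<le> Max (level T ` nodes T)"
        using fin u(1) by simp
      then have "Max (level T ` nodes T) - level T ?u < Max (level T ` nodes T) - level T v"
        using u(2) by linarith
      from less.hyps[OF this u(1)] obtain p where "awalk ?u p (hst_root T)" by blast
      then have "awalk v ((v, ?u) # p) (hst_root T)"
        using False less.prems by (auto simp: awalk_Cons_iff arcs_tree_graph)
      then show ?thesis by blast
    qed
  qed
qed

lemma Metric_space_tree_dist:
  assumes T: "is_hst \<alpha> K T"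
  shows "Metric_space (nodes T) (tree_dist T)"
proof -
  have crt: "complete_rooted_tree K T" using T by (simp add: is_hst_def)
  interpret fin_digraph "tree_graph T" by (rule fin_digraph_tree_graph[OF crt])
  let ?c = "awalk_cost (arc_len T)"
  have lev: "level T (parent T v) = Suc (level T v)" if "v \<in> nodes T" "v \<noteq> hst_root T" for v
    using crt that by (auto simp: complete_rooted_tree_def)
  have pos: "0 < arc_len T e" if "e \<in> arcs (tree_graph T)" for e
  proof -
    obtain a b where e: "e = (a, b)" by (cases e)
    have "a \<noteq> hst_root T \<and> b = parent T a \<or> b \<noteq> hst_root T \<and> a = parent T b"
      using that unfolding arcs_tree_graph e by blast
    moreover have "a \<in> nodes T" "b \<in> nodes T"
      using tail_in_verts[OF that] head_in_verts[OF that] by (simp_all add: e)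
    moreover have "\<forall>v\<in>nodes T - {hst_root T}. 0 < edge_len T v"
      using T by (simp add: is_hst_def)
    ultimately show ?thesis unfolding arc_len_def e by (auto split: if_splits)
  qed
  have nonneg: "0 \<le> arc_len T e" if "e \<in> arcs (tree_graph T)" for e
    using pos[OF that] by simp
  have cost_nonneg: "0 \<le> ?c p" if "awalk u p v" for u p v
    using pos_cost_pos_awalk_cost[OF that nonneg] .
  have sym_arc: "(b, a) \<in> arcs (tree_graph T) \<and> arc_len T (b, a) = arc_len T (a, b)"
    if "(a, b) \<in> arcs (tree_graph T)" for a b
  proof -
    have "\<not> (parent T a = b \<and> parent T b = a \<and> a \<noteq> hst_root T \<and> b \<noteq> hst_root T \<and> a \<in> nodes T \<and> b \<in> nodes T)"
    proof
      assume *: "parent T a = b \<and> parent T b = a \<and> a \<noteq> hst_root T \<and> b \<noteq> hst_root T \<and>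
        a \<in> nodes T \<and> b \<in> nodes T"
      then have "level T b = Suc (level T a)" "level T a = Suc (level T b)"
        using lev[of a] lev[of b] by simp_all
      then show False by simp
    qed
    moreover have "a \<noteq> hst_root T \<and> a \<in> nodes T \<and> b = parent T a \<or>
        b \<noteq> hst_root T \<and> b \<in> nodes T \<and> a = parent T b"
      using that unfolding arcs_tree_graph by blast
    moreover have "a \<in> nodes T" "b \<in> nodes T"
      using tail_in_verts[OF that] head_in_verts[OF that] by simp_all
    ultimately show ?thesis unfolding arcs_tree_graph arc_len_def by auto
  qed
  have rev: "\<exists>q. awalk v q u \<and> ?c q = ?c p" if "awalk u p v" for u p v
    using that
  proof (induction p arbitrary: u)
    case Nil
    then show ?case by (intro exI[of _ "[]"]) (auto simp: awalk_Nil_iff)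
  next
    case (Cons e p)
    obtain a b where e: "e = (a, b)" by (cases e)
    from Cons.prems have ab: "(a, b) \<in> arcs (tree_graph T)" "u = a" "awalk b p v"
      by (auto simp: awalk_Cons_iff e)
    from Cons.IH[OF ab(3)] obtain q where q: "awalk v q b" "?c q = ?c p" by blast
    have "awalk b [(b, a)] a"
      using sym_arc[OF ab(1)] arc_implies_awalk[of "(b, a)"] by simp
    from awalk_appendI[OF q(1) this] show ?case
      using q(2) sym_arc[OF ab(1)] ab(2) e by (intro exI[of _ "q @ [(b, a)]"]) auto
  qed
  have conn: "\<exists>p. awalk u p v" if uv: "u \<in> nodes T" "v \<in> nodes T" for u v
  proof -
    obtain p q where p: "awalk u p (hst_root T)" and q: "awalk v q (hst_root T)"
      using tree_reaches_root[OF crt uv(1)] tree_reaches_root[OF crt uv(2)] by blast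
    obtain q' where "awalk (hst_root T) q' v" using rev[OF q] by blast
    from awalk_appendI[OF p this] show ?thesis by blast
  qed
  have mu_att: "\<exists>p. awalk u p v \<and> \<mu> (arc_len T) u v = ereal (?c p)"
    if "u \<in> nodes T" "v \<in> nodes T" for u v
  proof -
    have "u \<rightarrow>\<^sup>*\<^bsub>tree_graph T\<^esub> v" using conn[OF that] by (simp add: reachable_awalk)
    from min_cost_awalk[OF this, of "arc_len T"] nonneg show ?thesis
      unfolding apath_def by blast
  qed
  have att: "\<exists>p. awalk u p v \<and> tree_dist T u v = ?c p" if "u \<in> nodes T" "v \<in> nodes T" for u v
    using mu_att[OF that] unfolding tree_dist_def by (metis real_of_ereal.simps(1))
  have le: "tree_dist T u v \<le> ?c p" if "awalk u p v" for u p v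
  proof -
    have "\<mu> (arc_len T) u v \<noteq> - \<infinity>"
    proof
      assume "\<mu> (arc_len T) u v = - \<infinity>"
      moreover have "0 \<le> \<mu> (arc_len T) u v"
        unfolding \<mu>_def by (rule INF_greatest) (auto intro: cost_nonneg)
      ultimately show False by simp
    qed
    with min_cost_le_walk_cost[OF that, of "arc_len T"] show ?thesis
      unfolding tree_dist_def by (cases "\<mu> (arc_len T) u v") auto
  qed
  show ?thesis
  proof
    show "0 \<le> tree_dist T u v" for u v
      unfolding tree_dist_def \<mu>_def
      by (rule real_of_ereal_pos) (auto intro!: INF_greatest cost_nonneg)
    have "tree_dist T u v \<le> tree_dist T v u"
      if uv: "u \<in> nodes T" "v \<in> nodes T" for u v
    proof -
      obtain p where p: "awalk v p u" "tree_dist T v u = ?c p" using att[OF uv(2,1)] by blast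
      obtain q where "awalk u q v" "?c q = ?c p" using rev[OF p(1)] by blast
      then show ?thesis using le p(2) by metis
    qed
    moreover have "\<not> u \<in> nodes T \<or> \<not> v \<in> nodes T \<Longrightarrow> tree_dist T u v = 0" for u v
    proof -
      assume "\<not> u \<in> nodes T \<or> \<not> v \<in> nodes T"
      then have *: "{p. awalk u p v} = {}"
        using awalk_last_in_verts awalk_hd_in_verts by auto
      show "tree_dist T u v = 0" unfolding tree_dist_def \<mu>_def * by (simp add: top_ereal_def)
    qed
    ultimately show "tree_dist T u v = tree_dist T v u" for u v
      by (metis antisym)
    show "(tree_dist T u v = 0) = (u = v)" if uv: "u \<in> nodes T" "v \<in> nodes T" for u v
    proof
      assume 0: "tree_dist T u v = 0"
      obtain p where p: "awalk u p v" "?c p = 0" using att[OF uv] 0 by auto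
      show "u = v"
      proof (cases p)
        case Nil
        then show ?thesis using p by (simp add: awalk_Nil_iff)
      next
        case (Cons e q)
        then have "0 < arc_len T e" "0 \<le> ?c q" using p pos cost_nonneg by (auto simp: awalk_Cons_iff)
        then show ?thesis using p(2) Cons by simp
      qed
    next
      assume "u = v"
      then have "awalk u [] v" using uv by (simp add: awalk_Nil_iff)
      moreover obtain p where "awalk u p v" "tree_dist T u v = ?c p" using att[OF uv] by blast
      ultimately show "tree_dist T u v = 0" using le[of u "[]" v] cost_nonneg[of u p v] by simp
    qed
    show "tree_dist T u w \<le> tree_dist T u v + tree_dist T v w"
      if uvw: "u \<in> nodes T" "v \<in> nodes T" "w \<in> nodes T" for u v w
    proof -
      obtain p q where pq: "awalk u p v" "tree_dist T u v = ?c p" "awalk v q w" "tree_dist T v w = ?c q"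
        using att[OF uvw(1,2)] att[OF uvw(2,3)] by blast
      from le[OF awalk_appendI[OF pq(1,3)]] pq(2,4) show ?thesis by simp
    qed
  qed
qed


section \<open>Parking Permit, interval version\<close>

text \<open>
  \<open>permits I k\<close> is the set of time intervals of the permits of type \<open>k\<close>. As the same interval
  may be available for several types, an individual permit is a pair of a type and an interval.
\<close>

record parking =
  days :: "nat set"
  permits :: "nat \<Rightarrow> nat set set"
  pcost :: "nat \<Rightarrow> real"
  duration :: "nat \<Rightarrow> nat"

definition interval_parking :: "nat \<Rightarrow> parking \<Rightarrow> bool" where
  "interval_parking K I \<longleftrightarrow>
     (\<forall>k\<in>{1..K}. 0 < pcost I k \<and> 0 < duration I k \<and> partition_on (days I) (permits I k) \<and>
        (\<forall>P\<in>permits I k. \<exists>s. P = {s..<s + duration I k})) \<and>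
     (\<forall>k\<in>{2..K}. 2 * pcost I (k - 1) \<le> pcost I k \<and>
        duration I (k - 1) \<le> duration I k \<and> duration I (k - 1) dvd duration I k \<and>
        (\<forall>P\<in>permits I k. partition_on P {Q \<in> permits I (k - 1). Q \<subseteq> P} \<and>
           card {Q \<in> permits I (k - 1). Q \<subseteq> P} = duration I k div duration I (k - 1)))"

type_synonym permit = "nat \<times> nat set"

definition is_permit :: "nat \<Rightarrow> parking \<Rightarrow> permit \<Rightarrow> bool" where
  "is_permit K I p \<longleftrightarrow> fst p \<in> {1..K} \<and> snd p \<in> permits I (fst p)"

definition permits_cost :: "parking \<Rightarrow> permit list \<Rightarrow> real" where
  "permits_cost I ps = (\<Sum>p\<leftarrow>ps. pcost I (fst p))"

definition parking_opt :: "nat \<Rightarrow> parking \<Rightarrow> nat list \<Rightarrow> real" where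
  "parking_opt K I ts =
     Inf {permits_cost I ps |ps. (\<forall>p\<in>set ps. is_permit K I p) \<and> set ts \<subseteq> (\<Union>p\<in>set ps. snd p)}"

text \<open>
  A deterministic online algorithm maps the driving days revealed so far to the permits that
  it purchases in response to the last one.
\<close>

type_synonym parking_alg = "nat list \<Rightarrow> permit list"

definition purchased :: "parking_alg \<Rightarrow> nat list \<Rightarrow> nat \<Rightarrow> permit list" where
  "purchased B ts j = concat (map (\<lambda>i. B (take (Suc i) ts)) [0..<j])"

definition parking_feasible :: "nat \<Rightarrow> parking \<Rightarrow> parking_alg \<Rightarrow> bool" where
  "parking_feasible K I B \<longleftrightarrow>
     (\<forall>ts\<in>lists (days I). \<forall>j<length ts.
        (\<forall>p\<in>set (B (take (Suc j) ts)). is_permit K I p) \<and>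
        ts ! j \<in> (\<Union>p\<in>set (purchased B ts (Suc j)). snd p))"

definition parking_competitive :: "real \<Rightarrow> nat \<Rightarrow> parking \<Rightarrow> parking_alg \<Rightarrow> bool" where
  "parking_competitive c K I B \<longleftrightarrow>
     parking_feasible K I B \<and>
     (\<forall>ts\<in>lists (days I). permits_cost I (purchased B ts (length ts)) \<le> c * parking_opt K I ts)"

end

theory Submission
  imports Defs
begin

text \<open>
  Two days belonging to different permits of the longest type never compete for a permit, so it
  suffices to treat each permit of type \<open>K\<close> separately. Its sub-permits form a tree in which the
  leaves are the permits of type 1. With opening cost \<open>f = c\<^sub>1\<close> and an edge of length
  \<open>c\<^sub>k\<^sub>+\<^sub>1 - c\<^sub>k\<close> above each permit of type \<open>k\<close>, the cluster consisting of the leaves below a permit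
  of type \<open>k\<close> costs exactly \<open>c\<^sub>k\<close>, so the clustering optimum is at most the parking optimum; the
  edges grow geometrically because \<open>c\<^sub>k\<^sub>+\<^sub>1 \<ge> 2 c\<^sub>k\<close>. Conversely, any two leaves in a cluster of radius
  \<open>r\<close> have distance at most \<open>2 r\<close>, and leaves without a common ancestor permit of type \<open>k\<close> have
  distance at least \<open>2 (c\<^sub>k\<^sub>+\<^sub>1 - c\<^sub>1)\<close>. So, wherever its centre lies, the leaves of the cluster
  are contained in a single permit of the largest type \<open>k\<close> with \<open>c\<^sub>k \<le> f + r\<close>, which the parking
  algorithm buys instead.
\<close>

section \<open>Costs and competitiveness\<close>

lemma clusters_cost_nonneg:
  assumes "0 \<le> f" "\<And>C. C \<in> set Cs \<Longrightarrow> is_cluster M C"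
  shows "0 \<le> clusters_cost f Cs"
  unfolding clusters_cost_def using assms by (intro sum_list_nonneg) (auto simp: is_cluster_def)

lemma sum_radii_opt_le:
  assumes "0 \<le> f" "\<And>C. C \<in> set Cs \<Longrightarrow> is_cluster M C" "set us \<subseteq> covered M d Cs"
  shows "sum_radii_opt M d f us \<le> clusters_cost f Cs"
  unfolding sum_radii_opt_def
proof (rule cInf_lower)
  show "bdd_below {clusters_cost f Cs |Cs. (\<forall>C\<in>set Cs. is_cluster M C) \<and> set us \<subseteq> covered M d Cs}"
    using clusters_cost_nonneg[OF assms(1), of _ M] by (intro bdd_belowI[of _ 0]) blast
qed (use assms in auto)

lemma permits_cost_simps [simp]:
  "permits_cost I [] = 0"
  "permits_cost I (p # ps) = pcost I (fst p) + permits_cost I ps"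
  "permits_cost I (ps @ qs) = permits_cost I ps + permits_cost I qs"
  by (simp_all add: permits_cost_def)

lemma permits_cost_nonneg:
  assumes "interval_parking K I" "\<And>p. p \<in> set ps \<Longrightarrow> is_permit K I p"
  shows "0 \<le> permits_cost I ps"
  unfolding permits_cost_def using assms
  by (intro sum_list_nonneg) (force simp: is_permit_def interval_parking_def)

lemma parking_opt_le:
  assumes "interval_parking K I" "\<And>p. p \<in> set ps \<Longrightarrow> is_permit K I p"
    "set ts \<subseteq> (\<Union>p\<in>set ps. snd p)"
  shows "parking_opt K I ts \<le> permits_cost I ps"
  unfolding parking_opt_def
proof (rule cInf_lower)
  show "bdd_below {permits_cost I ps |ps. (\<forall>p\<in>set ps. is_permit K I p) \<and> set ts \<subseteq> (\<Union>p\<in>set ps. snd p)}"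
    using permits_cost_nonneg[OF assms(1)] by (intro bdd_belowI[of _ 0]) blast
qed (use assms in auto)

lemma opened_append:
  "j \<le> length us \<Longrightarrow> opened M d A (us @ vs) j = opened M d A us j"
  by (induction j) (simp_all add: Let_def nth_append)

text \<open>Decisions depend on the past only, so a run can be unrolled at its last demand;
  inductions from the right end use this form.\<close>

lemma opened_snoc:
  "opened M d A (us @ [u]) (Suc (length us)) =
    (let Cs = opened M d A us (length us) in
     if u \<in> covered M d Cs then Cs else Cs @ [A (us @ [u])])"
  by (simp add: opened_append Let_def)

lemma purchased_take:
  assumes "j \<le> length ts"
  shows "purchased B ts j = purchased B (take j ts) j"
  unfolding purchased_def using assms
  by (intro arg_cong[where f = concat] map_cong) (auto simp: min_def)

lemma purchased_snoc:
  "purchased B (ts @ [t]) (Suc (length ts)) = purchased B ts (length ts) @ B (ts @ [t])"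
  using purchased_take[of "length ts" "ts @ [t]" B] by (simp add: purchased_def)

text \<open>Prefixes of sequences of days are again such sequences, so looking at complete sequences
  replaces looking at every index.\<close>

lemma parking_feasibleI:
  assumes "\<And>ts p. ts \<in> lists (days I) \<Longrightarrow> ts \<noteq> [] \<Longrightarrow> p \<in> set (B ts) \<Longrightarrow> is_permit K I p"
    and "\<And>ts. ts \<in> lists (days I) \<Longrightarrow> set ts \<subseteq> (\<Union>p\<in>set (purchased B ts (length ts)). snd p)"
  shows "parking_feasible K I B"
  unfolding parking_feasible_def
proof (intro ballI allI impI conjI)
  fix ts j assume ts: "ts \<in> lists (days I)" "j < length ts"
  then have take: "take (Suc j) ts \<in> lists (days I)" "take (Suc j) ts \<noteq> []"
    by (auto dest: in_set_takeD)
  then show "is_permit K I p" if "p \<in> set (B (take (Suc j) ts))" for p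
    using assms(1) that by blast
  have "ts ! j \<in> set (take (Suc j) ts)"
    using ts(2) by (auto simp: in_set_conv_nth)
  moreover have "length (take (Suc j) ts) = Suc j" using ts(2) by simp
  ultimately show "ts ! j \<in> (\<Union>p\<in>set (purchased B ts (Suc j)). snd p)"
    using assms(2)[OF take(1)] purchased_take[of "Suc j" ts B] ts(2) by auto
qed

lemma parking_feasibleD:
  assumes "parking_feasible K I B" "set ts \<subseteq> days I" "j < length ts"
  shows "p \<in> set (B (take (Suc j) ts)) \<Longrightarrow> is_permit K I p"
    "ts ! j \<in> (\<Union>p\<in>set (purchased B ts (Suc j)). snd p)"
proof -
  have "ts \<in> lists (days I)" using assms(2) by auto
  with assms(1,3) have "(\<forall>p\<in>set (B (take (Suc j) ts)). is_permit K I p) \<and>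
      ts ! j \<in> (\<Union>p\<in>set (purchased B ts (Suc j)). snd p)"
    unfolding parking_feasible_def by (elim ballE allE impE) auto
  then show "p \<in> set (B (take (Suc j) ts)) \<Longrightarrow> is_permit K I p"
    "ts ! j \<in> (\<Union>p\<in>set (purchased B ts (Suc j)). snd p)"
    by blast+
qed

text \<open>Trades the infimum for an arbitrary covering list of permits.\<close>

lemma parking_competitiveI:
  assumes I: "interval_parking K I" "1 \<le> K" and c: "0 \<le> c"
    and feas: "parking_feasible K I B"
    and cost: "\<And>ts ps. ts \<in> lists (days I) \<Longrightarrow> (\<And>p. p \<in> set ps \<Longrightarrow> is_permit K I p) \<Longrightarrow>
      set ts \<subseteq> (\<Union>p\<in>set ps. snd p) \<Longrightarrow>
      permits_cost I (purchased B ts (length ts)) \<le> c * permits_cost I ps"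
  shows "parking_competitive c K I B"
  unfolding parking_competitive_def
proof (intro conjI ballI feas)
  fix ts assume ts: "ts \<in> lists (days I)"
  let ?S = "{permits_cost I ps |ps. (\<forall>p\<in>set ps. is_permit K I p) \<and> set ts \<subseteq> (\<Union>p\<in>set ps. snd p)}"
  let ?x = "permits_cost I (purchased B ts (length ts))"
  have le: "?x \<le> c * y" if "y \<in> ?S" for y
    using that cost[OF ts] by blast
  \<comment> \<open>Permits of type 1 alone cover all driving days, so the infimum is taken over a
    nonempty set and is not a junk value.\<close>
  have "\<exists>Q. Q \<in> permits I 1 \<and> t \<in> Q" if "t \<in> set ts" for t
  proof -
    have "days I = \<Union> (permits I 1)"
      using I by (intro partition_onD1) (auto simp: interval_parking_def)
    then show ?thesis using that ts by auto
  qed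
  then obtain Q where Q: "\<And>t. t \<in> set ts \<Longrightarrow> Q t \<in> permits I 1 \<and> t \<in> Q t"
    by metis
  let ?ps = "map (\<lambda>t. (1, Q t)) ts"
  have "(\<forall>p\<in>set ?ps. is_permit K I p) \<and> set ts \<subseteq> (\<Union>p\<in>set ?ps. snd p)"
    using Q I(2) by (auto simp: is_permit_def)
  then have ne: "?S \<noteq> {}" by blast
  show "?x \<le> c * parking_opt K I ts"
  \<comment> \<open>Moving \<open>c\<close> through the infimum divides by it; for
    \<open>c = 0\<close> any single covering gives the bound.\<close>
  proof (cases "c = 0")
    case True
    then show ?thesis using le ne by auto
  next
    case False
    then have "?x / c \<le> Inf ?S"
      using c le ne by (intro cInf_greatest) (auto simp: field_simps)
    then show ?thesis
      using False c by (simp add: parking_opt_def field_simps)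
  qed
qed

text \<open>One demand already forces a positive online cost, whereas the optimum is nonnegative.
  The sign is needed to multiply bounds on the optimum by \<open>c\<close>.\<close>

lemma sum_radii_competitive_imp_nonneg:
  assumes A: "sum_radii_competitive c M d f A" and f: "0 < f" and M: "Metric_space M d" "u \<in> M"
  shows "0 \<le> c"
proof -
  interpret Metric_space M d by fact
  have "is_cluster M (A [u])"
    using A M(2) unfolding sum_radii_competitive_def sum_radii_feasible_def
    by (auto simp: covered_def dest!: bspec[of _ _ "[u]"])
  then have "0 < clusters_cost f (opened M d A [u] (length [u]))"
    using f by (simp add: clusters_cost_def covered_def is_cluster_def)
  also have "\<dots> \<le> c * sum_radii_opt M d f [u]"
    using A M(2) unfolding sum_radii_competitive_def by (auto dest!: bspec[of _ _ "[u]"])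
  finally have pos: "0 < c * sum_radii_opt M d f [u]" .
  have "0 \<le> sum_radii_opt M d f [u]"
    unfolding sum_radii_opt_def
  proof (rule cInf_greatest)
    have "(\<forall>C\<in>set [(u, 0)]. is_cluster M C) \<and> set [u] \<subseteq> covered M d [(u, 0)]"
      using M(2) by (simp add: is_cluster_def covered_def cluster_points_def)
    then show "{clusters_cost f Cs |Cs. (\<forall>C\<in>set Cs. is_cluster M C) \<and> set [u] \<subseteq> covered M d Cs} \<noteq> {}"
      by blast
    show "0 \<le> x" if "x \<in> {clusters_cost f Cs |Cs. (\<forall>C\<in>set Cs. is_cluster M C) \<and> set [u] \<subseteq> covered M d Cs}" for x
      using that clusters_cost_nonneg[OF less_imp_le[OF f], of _ M] by blast
  qed
  with pos show ?thesis
    by (simp add: zero_less_mult_iff)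
qed


section \<open>Distances in HSTs\<close>

text \<open>Levels rise towards the root, so \<open>v\<close> is not the parent of its own parent,
  and the test in \<open>arc_len\<close> finds the child end in both directions.\<close>

lemma arc_len_tree:
  assumes T: "is_hst \<alpha> K T" and v: "v \<in> nodes T" "v \<noteq> hst_root T"
  shows "arc_len T (v, parent T v) = edge_len T v" "arc_len T (parent T v, v) = edge_len T v"
proof -
  have lev: "level T (parent T v) = Suc (level T v)" "parent T v \<in> nodes T"
    using T v by (auto simp: is_hst_def complete_rooted_tree_def)
  have "level T (parent T (parent T v)) = Suc (level T (parent T v))" if "parent T v \<noteq> hst_root T"
    using T lev(2) that by (auto simp: is_hst_def complete_rooted_tree_def)
  then have "\<not> (parent T v \<noteq> hst_root T \<and> parent T (parent T v) = v)"
    using lev by auto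
  then show "arc_len T (parent T v, v) = edge_len T v"
    by (auto simp: arc_len_def)
qed (use v in \<open>simp add: arc_len_def\<close>)

lemma tree_dist_parent_le:
  assumes T: "is_hst \<alpha> K T" and v: "v \<in> nodes T" "v \<noteq> hst_root T"
  shows "tree_dist T v (parent T v) \<le> edge_len T v"
proof -
  have crt: "complete_rooted_tree K T" using T by (simp add: is_hst_def)
  interpret fin_digraph "tree_graph T" by (rule fin_digraph_tree_graph[OF crt])
  have "(v, parent T v) \<in> arcs (tree_graph T)"
    using v by (auto simp: arcs_tree_graph)
  then have "awalk v [(v, parent T v)] (parent T v)"
    using arc_implies_awalk by fastforce
  from min_cost_le_walk_cost[OF this, of "arc_len T"]
  have "\<mu> (arc_len T) v (parent T v) \<le> ereal (edge_len T v)"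
    using arc_len_tree[OF T v] by simp
  moreover have "0 < edge_len T v"
    using T v by (simp add: is_hst_def)
  ultimately show ?thesis
    unfolding tree_dist_def by (cases "\<mu> (arc_len T) v (parent T v)") auto
qed

text \<open>Such a potential telescopes along every walk. This yields lower bounds on distances
  without describing paths in the tree.\<close>

lemma tree_dist_ge_lipschitz:
  assumes T: "is_hst \<alpha> K T"
    and lip: "\<And>v. v \<in> nodes T \<Longrightarrow> v \<noteq> hst_root T \<Longrightarrow> \<bar>\<phi> v - \<phi> (parent T v)\<bar> \<le> edge_len T v"
    and uv: "u \<in> nodes T" "v \<in> nodes T"
  shows "\<phi> u - \<phi> v \<le> tree_dist T u v"
proof -
  have crt: "complete_rooted_tree K T" using T by (simp add: is_hst_def)
  interpret fin_digraph "tree_graph T" by (rule fin_digraph_tree_graph[OF crt])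
  have arc: "\<phi> (fst e) - \<phi> (snd e) \<le> arc_len T e" if e: "e \<in> arcs (tree_graph T)" for e
  proof -
    obtain w where w: "w \<in> nodes T" "w \<noteq> hst_root T" "e = (w, parent T w) \<or> e = (parent T w, w)"
      using e unfolding arcs_tree_graph by blast
    then show ?thesis
      using lip[OF w(1,2)] arc_len_tree[OF T w(1,2)] by auto
  qed
  have "\<phi> w - \<phi> v \<le> awalk_cost (arc_len T) p" if "awalk w p v" for w p
    using that
  proof (induction p arbitrary: w)
    case Nil
    then show ?case by (simp add: awalk_Nil_iff)
  next
    case (Cons e p)
    then show ?case using arc[of e] by (force simp: awalk_Cons_iff)
  qed
  then have mu: "ereal (\<phi> u - \<phi> v) \<le> \<mu> (arc_len T) u v"
    unfolding \<mu>_def by (intro INF_greatest) auto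
  show ?thesis
  \<comment> \<open>\<open>real_of_ereal\<close> sends \<infinity> to 0, and distance 0 forces
    \<open>u = v\<close>, so the infinite case needs no walk.\<close>
  proof (cases "\<mu> (arc_len T) u v = \<infinity>")
    case True
    interpret Metric_space "nodes T" "tree_dist T"
      by (rule Metric_space_tree_dist[OF T])
    have "tree_dist T u v = 0" using True by (simp add: tree_dist_def)
    then show ?thesis using uv by simp
  next
    case False
    then show ?thesis
      using mu unfolding tree_dist_def by (cases "\<mu> (arc_len T) u v") auto
  qed
qed

text \<open>A path with \<open>K + 1\<close> nodes whose edge lengths double towards the root. It
  supplies one instance from which the sign of \<open>c\<close> can be read off.\<close>

lemma ex_hst: "\<exists>T. is_hst 2 K T"
proof
  have "v = 0" if "{u. u \<le> K \<and> u \<noteq> K \<and> Suc u = v} = {}" "v \<le> K" for v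
  proof (cases v)
    case (Suc u)
    then have "u \<in> {u. u \<le> K \<and> u \<noteq> K \<and> Suc u = v}" using that(2) by simp
    then show ?thesis using that(1) by blast
  qed
  then show "is_hst 2 K \<lparr>nodes = {..K}, hst_root = K, parent = Suc, level = id, edge_len = (^) 2\<rparr>"
    unfolding is_hst_def complete_rooted_tree_def children_def by auto
qed


section \<open>Permits of different types\<close>

lemma interval_parkingD:
  assumes "interval_parking K I" "1 \<le> k" "k \<le> K"
  shows "0 < pcost I k" "0 < duration I k" "partition_on (days I) (permits I k)"
    "P \<in> permits I k \<Longrightarrow> \<exists>s. P = {s..<s + duration I k}"
  using assms by (auto simp: interval_parking_def)

lemma permit_eq:
  assumes "interval_parking K I" "1 \<le> k" "k \<le> K"
    and "Q \<in> permits I k" "P \<in> permits I k" "t \<in> Q" "t \<in> P"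
  shows "Q = P"
  using partition_onD2[OF interval_parkingD(3)[OF assms(1-3)]] assms(4-)
  by (auto simp: disjoint_def)

text \<open>Induction on \<open>m\<close>: the subpermit of \<open>P\<close> one type lower that
  contains \<open>t\<close> already contains \<open>Q\<close>.\<close>

lemma permit_nested:
  assumes I: "interval_parking K I" and k: "1 \<le> k" "k \<le> m" "m \<le> K"
    and QP: "Q \<in> permits I k" "P \<in> permits I m" "t \<in> Q" "t \<in> P"
  shows "Q \<subseteq> P"
  using k(2,3) QP(2,4)
proof (induction m arbitrary: P rule: dec_induct)
  case base
  then show ?case using permit_eq[OF I, of k Q P t] k QP by auto
next
  case (step n)
  then have "Suc n \<in> {2..K}" using k by auto
  then have "partition_on P {Q \<in> permits I n. Q \<subseteq> P}"
    using I step.prems(2) unfolding interval_parking_def by force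
  from partition_onD1[OF this] step.prems(3) obtain R where "R \<in> permits I n" "R \<subseteq> P" "t \<in> R"
    by auto
  then show ?case using step.IH[of R] step.prems(1) by auto
qed

definition restrict_parking :: "parking \<Rightarrow> nat set \<Rightarrow> parking" where
  "restrict_parking I P = I\<lparr>days := P, permits := \<lambda>k. {Q \<in> permits I k. Q \<subseteq> P}\<rparr>"

lemma restrict_parking_simps [simp]:
  "days (restrict_parking I P) = P"
  "permits (restrict_parking I P) k = {Q \<in> permits I k. Q \<subseteq> P}"
  "pcost (restrict_parking I P) = pcost I"
  "duration (restrict_parking I P) = duration I"
  by (simp_all add: restrict_parking_def)

lemma permits_cost_restrict [simp]: "permits_cost (restrict_parking I P) ps = permits_cost I ps"
  by (simp add: permits_cost_def)

lemma is_permit_restrict [simp]: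
  "is_permit K (restrict_parking I P) p \<longleftrightarrow> is_permit K I p \<and> snd p \<subseteq> P"
  by (auto simp: is_permit_def)

text \<open>A permit sharing a day with \<open>P\<close> lies inside \<open>P\<close> by
  \<open>permit_nested\<close>, so the permits kept still cover every day of
  \<open>P\<close>.\<close>

lemma interval_parking_restrict:
  assumes I: "interval_parking K I" and P: "P \<in> permits I K" "1 \<le> K"
  shows "interval_parking K (restrict_parking I P)"
proof -
  have part: "partition_on P {Q \<in> permits I k. Q \<subseteq> P}" if k: "1 \<le> k" "k \<le> K" for k
  proof (rule partition_onI)
    have "t \<in> \<Union> {Q \<in> permits I k. Q \<subseteq> P}" if t: "t \<in> P" for t
    proof -
      have "t \<in> days I"
        using P t partition_onD1[OF interval_parkingD(3)[OF I P(2)]] by auto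
      then obtain Q where Q: "Q \<in> permits I k" "t \<in> Q"
        using partition_onD1[OF interval_parkingD(3)[OF I k]] by auto
      with permit_nested[OF I k order_refl Q(1) P(1) Q(2) t] show ?thesis by auto
    qed
    then show "\<Union> {Q \<in> permits I k. Q \<subseteq> P} = P" by blast
    show "disjnt Q R" if "Q \<in> {Q \<in> permits I k. Q \<subseteq> P}" "R \<in> {Q \<in> permits I k. Q \<subseteq> P}" "Q \<noteq> R" for Q R
      using permit_eq[OF I k, of Q R] that by (auto simp: disjnt_def)
    show "{} \<notin> {Q \<in> permits I k. Q \<subseteq> P}"
      using partition_onD3[OF interval_parkingD(3)[OF I k]] by auto
  qed
  have sub: "{Q \<in> permits I k. Q \<subseteq> P \<and> Q \<subseteq> R} = {Q \<in> permits I k. Q \<subseteq> R}" if "R \<subseteq> P" for k R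
    using that by auto
  show ?thesis
    using I part unfolding interval_parking_def by (auto simp: sub)
qed


section \<open>A single permit of the longest type\<close>

locale rooted_parking =
  fixes K :: nat and I :: parking
  assumes K: "1 \<le> K" and I: "interval_parking K I" and permits_K: "permits I K = {days I}"
begin

text \<open>
  The nodes of the tree on level \<open>j < K\<close> are the permits of type \<open>j + 1\<close>. Since only \<open>K\<close> of the
  \<open>K + 1\<close> levels are used by the permits, the tree gets an additional root on level \<open>K\<close>, whose only
  child is the permit of type \<open>K\<close>; it corresponds to a fictitious permit type of cost
  \<open>2 * pcost I K\<close>.
\<close>

definition cst :: "nat \<Rightarrow> real" where
  "cst j = (if j < K then pcost I (Suc j) else 2 * pcost I K)"

text \<open>The \<open>min\<close> lets level \<open>K\<close> reuse the permits of type
  \<open>K\<close>: the extra root stands for the same days as its only child.\<close>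

definition block :: "nat \<Rightarrow> nat \<Rightarrow> nat set" where
  "block j t = (THE Q. Q \<in> permits I (Suc (min j (K - 1))) \<and> t \<in> Q)"

definition rep :: "nat \<Rightarrow> nat \<Rightarrow> nat" where
  "rep j t = Min (block j t)"

text \<open>The least day names a permit within its type; pairing it with the level keeps permits of
  different types apart even when their intervals coincide.\<close>

definition anc :: "nat \<Rightarrow> nat \<Rightarrow> nat" where
  "anc j t = prod_encode (j, rep j t)"

text \<open>Decoding a node recovers only a representative day, so \<open>parent\<close> climbs from
  that day; by \<open>rep_rep\<close> the result is the same for every day of the permit.\<close>

definition tree :: hst where
  "tree = \<lparr>nodes = (\<lambda>(j, t). anc j t) ` ({..K} \<times> days I),
     hst_root = anc K (Min (days I)),
     parent = (\<lambda>v. case prod_decode v of (j, t) \<Rightarrow> anc (Suc j) t),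
     level = (\<lambda>v. fst (prod_decode v)),
     edge_len = (\<lambda>v. case prod_decode v of (j, t) \<Rightarrow> cst (Suc j) - cst j)\<rparr>"

section \<open>Growth of the costs along the levels\<close>

lemma cst_pos: "0 < cst j"
  using K interval_parkingD(1)[OF I] by (simp add: cst_def)

lemma cst_double: "j < K \<Longrightarrow> 2 * cst j \<le> cst (Suc j)"
proof (cases "Suc j < K")
  case True
  then have "Suc (Suc j) \<in> {2..K}" by auto
  with I have "2 * pcost I (Suc (Suc j) - 1) \<le> pcost I (Suc (Suc j))"
    unfolding interval_parking_def by blast
  then show ?thesis using True by (simp add: cst_def)
next
  case False
  assume "j < K"
  with False have "Suc j = K" by simp
  then show ?thesis by (auto simp: cst_def)
qed

lemma cst_mono: "i \<le> j \<Longrightarrow> j \<le> K \<Longrightarrow> cst i \<le> cst j"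
proof (induction j rule: dec_induct)
  case (step n)
  then show ?case using cst_double[of n] cst_pos[of n] by simp
qed simp

section \<open>Days, blocks and representatives\<close>

lemma days_eq: "\<exists>s. days I = {s..<s + duration I K}"
  using interval_parkingD(4)[OF I K] permits_K by simp

lemma finite_days: "finite (days I)" and days_nonempty: "days I \<noteq> {}"
  using days_eq partition_onD3[OF interval_parkingD(3)[OF I K]] permits_K by auto

lemma block_eqI:
  assumes "Q \<in> permits I (Suc (min j (K - 1)))" "t \<in> Q"
  shows "block j t = Q"
  unfolding block_def
proof (rule the_equality)
  fix R assume "R \<in> permits I (Suc (min j (K - 1))) \<and> t \<in> R"
  then show "R = Q"
    using assms K by (intro permit_eq[OF I, of "Suc (min j (K - 1))" R Q t]) auto
qed (use assms in simp)

lemma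
  assumes "t \<in> days I"
  shows block_permit: "block j t \<in> permits I (Suc (min j (K - 1)))" and in_block: "t \<in> block j t"
proof -
  let ?k = "Suc (min j (K - 1))"
  have k: "1 \<le> ?k" "?k \<le> K" using K by auto
  have "t \<in> \<Union> (permits I ?k)"
    using partition_onD1[OF interval_parkingD(3)[OF I k]] assms by auto
  then obtain Q where "Q \<in> permits I ?k" "t \<in> Q" by blast
  then show "block j t \<in> permits I ?k" "t \<in> block j t"
    using block_eqI by auto
qed

lemma permit_sub_days: "Q \<in> permits I k \<Longrightarrow> 1 \<le> k \<Longrightarrow> k \<le> K \<Longrightarrow> Q \<subseteq> days I"
  using partition_onD1[OF interval_parkingD(3)[OF I]] by blast

lemma block_sub_days: "t \<in> days I \<Longrightarrow> block j t \<subseteq> days I"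
  using block_permit permit_sub_days K by force

lemma rep_in_block: "t \<in> days I \<Longrightarrow> rep j t \<in> block j t"
  unfolding rep_def using block_sub_days[of t j] in_block[of t j] finite_days
  by (intro Min_in) (auto intro: finite_subset)

text \<open>By nestedness the representative of the smaller block also lies in the larger
  one.\<close>

lemma block_rep:
  assumes "t \<in> days I" "j \<le> i"
  shows "block i (rep j t) = block i t"
proof -
  have "block j t \<subseteq> block i t"
    by (rule permit_nested[OF I _ _ _ block_permit[OF assms(1), of j] block_permit[OF assms(1), of i]
          in_block[OF assms(1)] in_block[OF assms(1)]]) (use K assms(2) in auto)
  then show ?thesis
    using rep_in_block[OF assms(1)] block_permit[OF assms(1)] by (intro block_eqI) auto
qed

lemma rep_rep [simp]: "t \<in> days I \<Longrightarrow> j \<le> i \<Longrightarrow> rep i (rep j t) = rep i t"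
  unfolding rep_def[of i] by (simp add: block_rep)

lemma rep_eq_iff:
  assumes "s \<in> days I" "t \<in> days I"
  shows "rep j s = rep j t \<longleftrightarrow> s \<in> block j t"
proof
  assume "rep j s = rep j t"
  then have "block j s = block j t"
    using block_rep[OF assms(1), of j j] block_rep[OF assms(2), of j j] by simp
  then show "s \<in> block j t" using in_block[OF assms(1), of j] by simp
next
  assume "s \<in> block j t"
  then show "rep j s = rep j t"
    unfolding rep_def using block_eqI[OF block_permit[OF assms(2)]] by metis
qed

lemma rep_top: "s \<in> days I \<Longrightarrow> t \<in> days I \<Longrightarrow> K - 1 \<le> j \<Longrightarrow> rep j s = rep j t"
  using block_permit[of t j] permits_K K by (auto simp: rep_eq_iff min_absorb2)

section \<open>Nodes of the tree and the separation of its edges\<close>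

lemma anc_eq_iff [simp]: "anc i s = anc j t \<longleftrightarrow> i = j \<and> rep i s = rep j t"
  by (auto simp: anc_def)

lemma tree_simps:
  "nodes tree = (\<lambda>(j, t). anc j t) ` ({..K} \<times> days I)"
  "hst_root tree = anc K (Min (days I))"
  "t \<in> days I \<Longrightarrow> parent tree (anc j t) = anc (Suc j) t"
  "level tree (anc j t) = j"
  "edge_len tree (anc j t) = cst (Suc j) - cst j"
  by (auto simp: tree_def anc_def)

lemma anc_node: "t \<in> days I \<Longrightarrow> j \<le> K \<Longrightarrow> anc j t \<in> nodes tree"
  by (auto simp: tree_simps)

lemma anc_root: "t \<in> days I \<Longrightarrow> anc j t = hst_root tree \<longleftrightarrow> j = K"
  using rep_top[of t "Min (days I)" K] finite_days days_nonempty by (auto simp: tree_simps)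

lemma nodeE:
  assumes "v \<in> nodes tree"
  obtains j t where "j \<le> K" "t \<in> days I" "v = anc j t"
  using assms by (auto simp: tree_simps)

lemma innerE:
  assumes "v \<in> nodes tree" "v \<noteq> hst_root tree"
  obtains j t where "j < K" "t \<in> days I" "v = anc j t"
  using assms by (metis nodeE anc_root le_neq_implies_less)

lemma childE:
  assumes "u \<in> children tree (anc j t)"
  obtains i s where "j = Suc i" "i < K" "s \<in> days I" "u = anc i s"
  using assms by (auto simp: children_def tree_simps(3) elim!: innerE)

definition sep :: real where
  "sep = 1 + cst 0 / cst K"

text \<open>By doubling, the edge above a node of level \<open>Suc i\<close> has length at least
  \<open>cst (Suc i)\<close>, while the edges below it have length
  \<open>cst (Suc i) - cst i\<close>. The gain is at least \<open>cst 0\<close> on an edge of length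
  at most \<open>cst K\<close>, hence the ratio \<open>sep\<close>.\<close>

lemma hst_tree: "is_hst sep K tree"
  unfolding is_hst_def complete_rooted_tree_def
proof (intro conjI ballI impI)
  show "finite (nodes tree)" by (simp add: tree_simps finite_days)
  show "hst_root tree \<in> nodes tree"
    using anc_node[of "Min (days I)" K] finite_days days_nonempty by (simp add: tree_simps(2))
  show "level tree (hst_root tree) = K" by (simp add: tree_simps)
next
  fix v assume "v \<in> nodes tree - {hst_root tree}"
  then obtain j t where v: "j < K" "t \<in> days I" "v = anc j t" by (auto elim: innerE)
  then show "parent tree v \<in> nodes tree" "level tree (parent tree v) = Suc (level tree v)"
    by (simp_all add: tree_simps(3,4) anc_node)
  show "0 < edge_len tree v"
    using v cst_double[of j] cst_pos[of j] by (simp add: tree_simps)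
  fix u assume "u \<in> children tree v"
  then obtain i s where u: "j = Suc i" "s \<in> days I" "u = anc i s" using v by (auto elim: childE)
  let ?x = "cst (Suc i) - cst i"
  have "?x \<le> cst K" using cst_mono[of "Suc i" K] cst_pos[of i] u v by simp
  then have "cst 0 / cst K * ?x \<le> cst 0"
    using cst_pos[of 0] cst_pos[of K] by (simp add: divide_simps)
  moreover have "cst 0 \<le> cst i" using cst_mono[of 0 i] u v by simp
  ultimately have "sep * ?x \<le> cst (Suc i)"
    by (simp add: sep_def algebra_simps)
  then show "sep * edge_len tree u \<le> edge_len tree v"
    using u v cst_double[of j] by (simp add: tree_simps)
next
  fix v assume v: "v \<in> nodes tree" "children tree v = {}"
  then obtain j t where jt: "j \<le> K" "t \<in> days I" "v = anc j t" by (auto elim: nodeE)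
  show "level tree v = 0"
  proof (cases j)
    case (Suc i)
    then have "anc i t \<in> children tree v"
      using jt anc_node[of t i] anc_root[of t i] by (simp add: children_def tree_simps(3))
    then show ?thesis using v by simp
  qed (simp add: jt tree_simps)
next
  fix v u u' assume "v \<in> nodes tree" "u \<in> children tree v" "u' \<in> children tree v"
  then show "edge_len tree u = edge_len tree u'"
    by (elim nodeE) (auto simp: tree_simps(5) elim!: childE)
qed

lemma sep_gt_1: "1 < sep"
  using cst_pos by (simp add: sep_def)

section \<open>Distances to and between leaves\<close>

sublocale M: Metric_space "nodes tree" "tree_dist tree"
  by (rule Metric_space_tree_dist[OF hst_tree])

text \<open>The edge lengths on the way up from the leaf telescope.\<close>

lemma dist_leaf_le:
  assumes "t \<in> days I" "j \<le> K"
  shows "tree_dist tree (anc j t) (anc 0 t) \<le> cst j - cst 0"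
  using assms(2)
proof (induction j)
  case 0
  then show ?case using anc_node[OF assms(1), of 0] by simp
next
  case (Suc j)
  have nodes: "anc i t \<in> nodes tree" if "i \<le> Suc j" for i
    using that Suc.prems by (intro anc_node assms) simp
  have "tree_dist tree (anc j t) (anc (Suc j) t) \<le> cst (Suc j) - cst j"
    using tree_dist_parent_le[OF hst_tree, of "anc j t"] nodes[of j] anc_root[OF assms(1), of j]
      Suc.prems assms(1) by (simp add: tree_simps(3,5))
  then show ?case
    using Suc M.triangle[OF nodes[of "Suc j"] nodes[of j] nodes[of 0]] M.commute[of "anc j t" "anc (Suc j) t"]
    by simp
qed

text \<open>
  The distance is bounded from below by a potential that decreases along the path from the leaf of
  \<open>s\<close> up to level \<open>m + 1\<close>, and keeps decreasing down to the leaf of \<open>t\<close>.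
\<close>

lemma dist_leaves_ge:
  assumes "s \<in> days I" "t \<in> days I" "m < K" "rep m s \<noteq> rep m t"
  shows "2 * (cst (Suc m) - cst 0) \<le> tree_dist tree (anc 0 s) (anc 0 t)"
proof -
  define \<phi> where "\<phi> v = (case prod_decode v of (j, x) \<Rightarrow>
     if m < j then 0 else if rep m x = rep m s then cst (Suc m) - cst j else cst j - cst (Suc m))" for v
  \<comment> \<open>The node stores \<open>rep j x\<close> instead of \<open>x\<close>; both have
    the same \<open>rep m\<close> for \<open>j \<le> m\<close>, and above level \<open>m\<close> the
    value is 0 anyway.\<close>
  have \<phi>: "\<phi> (anc j x) = (if m < j then 0 else if rep m x = rep m s then cst (Suc m) - cst j
     else cst j - cst (Suc m))" if "x \<in> days I" for j x
    using that by (simp add: \<phi>_def anc_def)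
  have "\<phi> (anc 0 s) - \<phi> (anc 0 t) \<le> tree_dist tree (anc 0 s) (anc 0 t)"
  proof (rule tree_dist_ge_lipschitz[OF hst_tree])
    fix v assume "v \<in> nodes tree" "v \<noteq> hst_root tree"
    then obtain j x where v: "j < K" "x \<in> days I" "v = anc j x" by (rule innerE)
    have "cst j \<le> cst (Suc j)" using cst_double[OF v(1)] cst_pos[of j] by simp
    then show "\<bar>\<phi> v - \<phi> (parent tree v)\<bar> \<le> edge_len tree v"
      \<comment> \<open>For \<open>j < m\<close> both ends lie on the same side, for
        \<open>j > m\<close> both values are 0; at \<open>j = m\<close> the edge joins the value 0
        to one of absolute value \<open>cst (Suc m) - cst m\<close>.\<close>
      using v by (cases "j = m") (auto simp: tree_simps(3,5) \<phi>)
  qed (use assms in \<open>auto intro: anc_node\<close>)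
  then show ?thesis using assms by (simp add: \<phi>)
qed

section \<open>From cluster radii to permit types\<close>

definition level_of :: "real \<Rightarrow> nat" where
  "level_of r = Max {j. j < K \<and> cst j \<le> cst 0 + r}"

text \<open>Level 0 always qualifies, so the maximum exists; the bound \<open>j < K\<close> keeps
  the fictitious type from being chosen.\<close>

lemma level_of:
  assumes "0 \<le> r"
  shows "level_of r < K" "cst (level_of r) \<le> cst 0 + r" "j < K \<Longrightarrow> cst j \<le> cst 0 + r \<Longrightarrow> j \<le> level_of r"
proof -
  let ?S = "{j. j < K \<and> cst j \<le> cst 0 + r}"
  have "0 \<in> ?S" using K assms by simp
  then have "Max ?S \<in> ?S" by (intro Max_in) auto
  then show "level_of r < K" "cst (level_of r) \<le> cst 0 + r" by (auto simp: level_of_def)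
  show "j \<le> level_of r" if "j < K" "cst j \<le> cst 0 + r"
    unfolding level_of_def using that by (intro Max_ge) auto
qed

text \<open>Both leaves are within distance \<open>2 * snd C\<close> of each other. In different
  blocks of level \<open>m\<close> they would be at least \<open>2 * (cst (Suc m) - cst 0)\<close>
  apart, which is larger by maximality of \<open>m\<close>.\<close>

lemma cluster_sub_block:
  assumes C: "is_cluster (nodes tree) C" and st: "s \<in> days I" "t \<in> days I"
    and mem: "anc 0 s \<in> cluster_points (nodes tree) (tree_dist tree) C"
      "anc 0 t \<in> cluster_points (nodes tree) (tree_dist tree) C"
  shows "s \<in> block (level_of (snd C)) t"
proof (rule ccontr)
  let ?m = "level_of (snd C)"
  have r: "0 \<le> snd C" "fst C \<in> nodes tree" using C by (auto simp: is_cluster_def)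
  note m = level_of[OF r(1)]
  assume "s \<notin> block ?m t"
  then have ne: "rep ?m s \<noteq> rep ?m t" using st by (simp add: rep_eq_iff)
  \<comment> \<open>Level \<open>K - 1\<close> has a single block, so the chosen level is lower and
    its maximality applies one level up.\<close>
  with rep_top[OF st, of ?m] m(1) have "Suc ?m < K" by linarith
  with m(3)[of "Suc ?m"] have "cst 0 + snd C < cst (Suc ?m)" by fastforce
  moreover have "tree_dist tree (anc 0 s) (anc 0 t) \<le> 2 * snd C"
    using M.triangle'[of "anc 0 s" "anc 0 t" "fst C"] mem r M.commute
      M.triangle[of "anc 0 s" "fst C" "anc 0 t"] anc_node[of _ 0] st
    by (fastforce simp: cluster_points_def)
  ultimately show False
    using dist_leaves_ge[OF st m(1) ne] by simp
qed

text \<open>The run of \<open>A\<close> is recomputed from the history; index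
  \<open>length ts - 1\<close> is the state before the last demand. Nothing is bought for a covered
  leaf, since the answer of \<open>A\<close> is ignored there.\<close>

definition online :: "nat sum_radii_alg \<Rightarrow> parking_alg" where
  "online A ts =
     (let us = map (anc 0) ts; m = level_of (snd (A us)) in
      if last us \<in> covered (nodes tree) (tree_dist tree)
           (opened (nodes tree) (tree_dist tree) A us (length ts - 1))
      then [] else [(Suc m, block m (last ts))])"

section \<open>Analysis of the simulation\<close>

context
  fixes A :: "nat sum_radii_alg" and c :: real
  assumes A: "sum_radii_competitive c (nodes tree) (tree_dist tree) (cst 0) A"
begin

abbreviation open_all :: "nat list \<Rightarrow> nat cluster list" where
  "open_all ts \<equiv> opened (nodes tree) (tree_dist tree) A (map (anc 0) ts) (length ts)"

abbreviation cpts :: "nat cluster \<Rightarrow> nat set" where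
  "cpts \<equiv> cluster_points (nodes tree) (tree_dist tree)"

lemma open_all_snoc:
  "open_all (ts @ [t]) = (if anc 0 t \<in> covered (nodes tree) (tree_dist tree) (open_all ts)
     then open_all ts else open_all ts @ [A (map (anc 0) (ts @ [t]))])"
  using opened_snoc[of "nodes tree" "tree_dist tree" A "map (anc 0) ts" "anc 0 t"]
  by (simp add: Let_def del: opened.simps)

lemma online_snoc:
  "online A (ts @ [t]) = (if anc 0 t \<in> covered (nodes tree) (tree_dist tree) (open_all ts) then []
     else let m = level_of (snd (A (map (anc 0) (ts @ [t])))) in [(Suc m, block m t)])"
  by (simp add: online_def Let_def opened_append del: opened.simps)

lemma new_cluster:
  assumes "set ts \<subseteq> days I" "t \<in> days I"
    and "anc 0 t \<notin> covered (nodes tree) (tree_dist tree) (open_all ts)"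
  shows "is_cluster (nodes tree) (A (map (anc 0) (ts @ [t])))"
    "anc 0 t \<in> cpts (A (map (anc 0) (ts @ [t])))"
proof -
  let ?us = "map (anc 0) (ts @ [t])"
  have "?us \<in> lists (nodes tree)" using assms by (auto intro!: anc_node)
  moreover have "length ts < length ?us" by simp
  moreover have "?us ! length ts \<notin> covered (nodes tree) (tree_dist tree)
      (opened (nodes tree) (tree_dist tree) A ?us (length ts))"
    using assms(3) by (simp add: nth_append opened_append)
  ultimately have "is_cluster (nodes tree) (A (take (Suc (length ts)) ?us)) \<and>
      ?us ! length ts \<in> cpts (A (take (Suc (length ts)) ?us))"
    using A unfolding sum_radii_competitive_def sum_radii_feasible_def by blast
  then show "is_cluster (nodes tree) (A ?us)" "anc 0 t \<in> cpts (A ?us)"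
    by (simp_all add: nth_append)
qed

lemma online_permit:
  assumes "ts \<in> lists (days I)" "ts \<noteq> []" "p \<in> set (online A ts)"
  shows "is_permit K I p"
proof -
  obtain ss t where ts: "ts = ss @ [t]" using assms(2) by (metis rev_exhaust)
  let ?m = "level_of (snd (A (map (anc 0) (ss @ [t]))))"
  have t: "set ss \<subseteq> days I" "t \<in> days I" using assms(1) ts by auto
  have new: "anc 0 t \<notin> covered (nodes tree) (tree_dist tree) (open_all ss)"
    and p: "p = (Suc ?m, block ?m t)"
    using assms(3) by (auto simp: ts online_snoc Let_def split: if_splits)
  have "?m < K"
    using level_of(1) new_cluster(1)[OF t new] by (simp add: is_cluster_def)
  then show ?thesis
    using block_permit[OF t(2), of ?m] K by (simp add: p is_permit_def min_absorb1)
qed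

text \<open>The second claim ranges over all days, not only the revealed ones: a later day whose
  leaf lies in an open cluster triggers no purchase and must be covered already. With the third
  claim it gives feasibility.\<close>

lemma online_invariant:
  assumes "set ts \<subseteq> days I"
  shows "permits_cost I (purchased (online A) ts (length ts)) \<le> clusters_cost (cst 0) (open_all ts)"
    "C \<in> set (open_all ts) \<Longrightarrow> t \<in> days I \<Longrightarrow> anc 0 t \<in> cpts C \<Longrightarrow>
       t \<in> (\<Union>p\<in>set (purchased (online A) ts (length ts)). snd p)"
    "t \<in> set ts \<Longrightarrow> anc 0 t \<in> covered (nodes tree) (tree_dist tree) (open_all ts)"
  using assms
proof (induction ts arbitrary: C t rule: rev_induct)
  case Nil
  {
    case 1 then show ?case by (simp add: purchased_def clusters_cost_def)
  next
    case 2 then show ?case by simp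
  next
    case 3 then show ?case by simp
  }
next
  case (snoc u ts)
  let ?C = "A (map (anc 0) (ts @ [u]))"
  let ?m = "level_of (snd ?C)"
  let ?new = "anc 0 u \<notin> covered (nodes tree) (tree_dist tree) (open_all ts)"
  have pur: "purchased (online A) (ts @ [u]) (length (ts @ [u])) =
      purchased (online A) ts (length ts) @ online A (ts @ [u])"
    by (simp add: purchased_snoc)
  {
    case 1
    then have u: "set ts \<subseteq> days I" "u \<in> days I" by auto
    have "pcost I (Suc ?m) \<le> cst 0 + snd ?C" if ?new
    proof -
      have "0 \<le> snd ?C" using new_cluster(1)[OF u that] by (simp add: is_cluster_def)
      from level_of(1,2)[OF this] show ?thesis by (simp add: cst_def)
    qed
    then show ?case
      using snoc.IH(1)[OF u(1)] unfolding pur open_all_snoc online_snoc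
      by (auto simp: Let_def clusters_cost_def)
  next
    case 2
    then have u: "set ts \<subseteq> days I" "u \<in> days I" by auto
    show ?case
    proof (cases "C \<in> set (open_all ts)")
      case True
      then show ?thesis using snoc.IH(2)[OF True 2(2,3) u(1)] unfolding pur by auto
    next
      case False
      with 2 have new: ?new and C: "C = ?C" unfolding open_all_snoc by (auto split: if_splits)
      have "t \<in> block ?m u"
        using cluster_sub_block[of ?C t u] new_cluster[OF u new] 2 u by (simp add: C)
      then show ?thesis
        using new unfolding pur online_snoc by (auto simp: Let_def)
    qed
  next
    case 3
    then have u: "set ts \<subseteq> days I" "u \<in> days I" by auto
    show ?case
      using snoc.IH(3)[OF _ u(1), of t] new_cluster(2)[OF u] 3(1)
      unfolding open_all_snoc by (auto simp: covered_def)
  }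
qed

text \<open>Each permit becomes the ball around its own tree node that just reaches its leaves; with
  opening cost \<open>cst 0\<close> the ball costs exactly as much as the permit.\<close>

lemma opt_le:
  assumes "set ts \<subseteq> days I" "\<And>p. p \<in> set ps \<Longrightarrow> is_permit K I p"
    "set ts \<subseteq> (\<Union>p\<in>set ps. snd p)"
  shows "sum_radii_opt (nodes tree) (tree_dist tree) (cst 0) (map (anc 0) ts) \<le> permits_cost I ps"
proof -
  define C where "C p = (anc (fst p - 1) (Min (snd p)), cst (fst p - 1) - cst 0)" for p :: permit
  have p: "1 \<le> fst p" "fst p - 1 < K" "snd p \<subseteq> days I"
      "t \<in> snd p \<Longrightarrow> block (fst p - 1) t = snd p" "Min (snd p) \<in> snd p" if "p \<in> set ps" for p t
  proof -
    have k: "1 \<le> fst p" "fst p \<le> K" "snd p \<in> permits I (fst p)"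
      using assms(2)[OF that] by (auto simp: is_permit_def)
    then show "1 \<le> fst p" "fst p - 1 < K" by auto
    show sub: "snd p \<subseteq> days I" using permit_sub_days k by blast
    have "Suc (min (fst p - 1) (K - 1)) = fst p" using k by auto
    then show "t \<in> snd p \<Longrightarrow> block (fst p - 1) t = snd p" using block_eqI k(3) by simp
    have "snd p \<noteq> {}"
      using partition_onD3[OF interval_parkingD(3)[OF I k(1,2)]] k(3) by auto
    then show "Min (snd p) \<in> snd p"
      using finite_subset[OF sub finite_days] by simp
  qed
  have "is_cluster (nodes tree) (C p)" if "p \<in> set ps" for p
    using p[OF that] cst_mono[of 0 "fst p - 1"] anc_node[of "Min (snd p)" "fst p - 1"]
    by (auto simp: is_cluster_def C_def)
  moreover have "anc 0 t \<in> covered (nodes tree) (tree_dist tree) (map C ps)" if t: "t \<in> set ts" for t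
  proof -
    obtain q where q: "q \<in> set ps" "t \<in> snd q" using assms(3) t by blast
    have td: "t \<in> days I" using assms(1) t by auto
    \<comment> \<open>The centre is written with the least day of the permit; it is the same node as
      for \<open>t\<close>, so \<open>dist_leaf_le\<close> applies.\<close>
    have "block (fst q - 1) (Min (snd q)) = block (fst q - 1) t"
      using p(4)[OF q(1)] p(5)[OF q(1)] q(2) by simp
    then have "C q = (anc (fst q - 1) t, cst (fst q - 1) - cst 0)"
      by (simp add: C_def anc_def rep_def)
    then have "anc 0 t \<in> cpts (C q)"
      using dist_leaf_le[OF td, of "fst q - 1"] p(2)[OF q(1)] anc_node[OF td, of 0]
      by (simp add: cluster_points_def)
    then show ?thesis using q by (auto simp: covered_def)
  qed
  ultimately have "sum_radii_opt (nodes tree) (tree_dist tree) (cst 0) (map (anc 0) ts)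
      \<le> clusters_cost (cst 0) (map C ps)"
    using cst_pos[of 0] by (intro sum_radii_opt_le) auto
  also have "clusters_cost (cst 0) (map C ps) = permits_cost I ps"
    unfolding clusters_cost_def permits_cost_def map_map
  proof (intro arg_cong[where f = sum_list] map_cong refl)
    fix q assume "q \<in> set ps"
    then show "((\<lambda>C. cst 0 + snd C) \<circ> C) q = pcost I (fst q)"
      using p(1,2)[of q] by (simp add: C_def cst_def)
  qed
  finally show ?thesis .
qed

lemma online_competitive:
  assumes "0 \<le> c"
  shows "parking_competitive c K I (online A)"
proof (rule parking_competitiveI[OF I K assms])
  show "parking_feasible K I (online A)"
  proof (rule parking_feasibleI)
    fix ts assume "ts \<in> lists (days I)"
    then have ts: "set ts \<subseteq> days I" by auto
    then show "set ts \<subseteq> (\<Union>p\<in>set (purchased (online A) ts (length ts)). snd p)"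
      using online_invariant(2,3)[OF ts] by (fastforce simp: covered_def)
  qed (rule online_permit)
  fix ts ps
  assume ts: "ts \<in> lists (days I)" and ps: "\<And>p. p \<in> set ps \<Longrightarrow> is_permit K I p"
    "set ts \<subseteq> (\<Union>p\<in>set ps. snd p)"
  from ts have sub: "set ts \<subseteq> days I" by auto
  then have "map (anc 0) ts \<in> lists (nodes tree)" by (auto intro!: anc_node)
  with A have "clusters_cost (cst 0) (open_all ts)
      \<le> c * sum_radii_opt (nodes tree) (tree_dist tree) (cst 0) (map (anc 0) ts)"
    unfolding sum_radii_competitive_def by (metis length_map)
  also have "\<dots> \<le> c * permits_cost I ps"
    by (intro mult_left_mono opt_le assms sub ps)
  finally show "permits_cost I (purchased (online A) ts (length ts)) \<le> c * permits_cost I ps"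
    using online_invariant(1)[OF sub] by linarith
qed

end

end


section \<open>Independence of the permits of the longest type\<close>

text \<open>A permit is nonempty and the longest permits are disjoint, so its cost is counted for at
  most one \<open>P\<close>.\<close>

lemma sum_permits_cost_filter_le:
  assumes I: "interval_parking K I" and K: "1 \<le> K"
    and F: "finite F" "F \<subseteq> permits I K" and ps: "\<And>p. p \<in> set ps \<Longrightarrow> is_permit K I p"
  shows "(\<Sum>P\<in>F. permits_cost I (filter (\<lambda>p. snd p \<subseteq> P) ps)) \<le> permits_cost I ps"
  using ps
proof (induction ps)
  case (Cons p ps)
  have p: "1 \<le> fst p" "fst p \<le> K" "snd p \<in> permits I (fst p)"
    using Cons.prems[of p] by (auto simp: is_permit_def)
  have pos: "0 < pcost I (fst p)" by (rule interval_parkingD(1)[OF I p(1,2)])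
  obtain t where t: "t \<in> snd p"
    using partition_onD3[OF interval_parkingD(3)[OF I p(1,2)]] p(3) by (metis ex_in_conv)
  have "(\<Sum>P\<in>F. if snd p \<subseteq> P then pcost I (fst p) else 0) = (\<Sum>P\<in>{P\<in>F. snd p \<subseteq> P}. pcost I (fst p))"
    by (rule sum.inter_filter[OF F(1), symmetric])
  also have "\<dots> = card {P\<in>F. snd p \<subseteq> P} * pcost I (fst p)" by simp
  also have "\<dots> \<le> 1 * pcost I (fst p)"
  proof -
    have "P = P'" if "P \<in> F" "snd p \<subseteq> P" "P' \<in> F" "snd p \<subseteq> P'" for P P'
      using permit_eq[OF I K order_refl, of P P' t] that t F(2) by auto
    then have "card {P\<in>F. snd p \<subseteq> P} \<le> 1"
      using F(1) by (auto simp: card_le_Suc0_iff_eq)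
    then show ?thesis using pos by (intro mult_right_mono) auto
  qed
  finally have 1: "(\<Sum>P\<in>F. if snd p \<subseteq> P then pcost I (fst p) else 0) \<le> pcost I (fst p)" by simp
  have "(\<Sum>P\<in>F. permits_cost I (filter (\<lambda>p. snd p \<subseteq> P) (p # ps))) =
      (\<Sum>P\<in>F. (if snd p \<subseteq> P then pcost I (fst p) else 0) + permits_cost I (filter (\<lambda>p. snd p \<subseteq> P) ps))"
    by (intro sum.cong) auto
  also have "\<dots> \<le> permits_cost I (p # ps)"
    using 1 Cons by (simp add: sum.distrib)
  finally show ?case .
qed simp

text \<open>One copy of the algorithm runs per longest permit and sees only the driving days there.
  Online costs add up over the copies, and every offline solution splits along the longest
  permits.\<close>

lemma parking_competitive_of_restrict:
  assumes I: "interval_parking K I" and K: "1 \<le> K" and c: "0 \<le> c"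
    and B: "\<And>P. P \<in> permits I K \<Longrightarrow> parking_competitive c K (restrict_parking I P) (B P)"
  shows "\<exists>B. parking_competitive c K I B"
proof -
  have part: "partition_on (days I) (permits I K)" by (rule interval_parkingD(3)[OF I K]) simp
  have "\<forall>t\<in>days I. \<exists>P. P \<in> permits I K \<and> t \<in> P"
    using partition_onD1[OF part] by blast
  then obtain permit_of where permit_of: "\<And>t. t \<in> days I \<Longrightarrow> permit_of t \<in> permits I K \<and> t \<in> permit_of t"
    by metis
  have permit_of_eq: "P = permit_of t" if "t \<in> days I" "P \<in> permits I K" "t \<in> P" for P t
    using permit_eq[OF I K order_refl] permit_of that by blast
  \<comment> \<open>A new day wakes only the copy in charge of it, which receives its own part of
    the history.\<close>
  define B' where "B' ts = B (permit_of (last ts)) (filter (\<lambda>t. t \<in> permit_of (last ts)) ts)" for ts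
  \<comment> \<open>All purchases made so far by the copy for \<open>P\<close>.\<close>
  define loc where "loc P ts = (let us = filter (\<lambda>t. t \<in> P) ts in purchased (B P) us (length us))" for P ts
  have loc_Nil: "loc P [] = []" for P by (simp add: loc_def purchased_def)
  have loc_snoc: "loc P (ts @ [t]) = loc P ts @ (if P = permit_of t then B' (ts @ [t]) else [])"
    if "t \<in> days I" "P \<in> permits I K" for P ts t
  proof (cases "t \<in> P")
    case True
    then have "P = permit_of t" using permit_of_eq that by blast
    with True show ?thesis by (simp add: loc_def B'_def purchased_snoc Let_def)
  next
    case False
    then have "P \<noteq> permit_of t" using permit_of[OF that(1)] by auto
    with False show ?thesis by (simp add: loc_def)
  qed
  let ?pur = "\<lambda>ts. purchased B' ts (length ts)"
  \<comment> \<open>There may be infinitely many longest permits, so the sum runs over a finite set;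
    allowing any \<open>F\<close> that contains the touched ones keeps it fixed when the induction
    passes to a prefix.\<close>
  have cost_eq: "permits_cost I (?pur ts) = (\<Sum>P\<in>F. permits_cost I (loc P ts))"
    if "set ts \<subseteq> days I" "permit_of ` set ts \<subseteq> F" "finite F" "F \<subseteq> permits I K" for ts F
    using that
  proof (induction ts rule: rev_induct)
    case Nil
    then show ?case by (simp add: loc_Nil purchased_def)
  next
    case (snoc t ts)
    then have t: "t \<in> days I" "permit_of t \<in> F" by auto
    have "(\<Sum>P\<in>F. permits_cost I (loc P (ts @ [t]))) =
        (\<Sum>P\<in>F. permits_cost I (loc P ts) + (if P = permit_of t then permits_cost I (B' (ts @ [t])) else 0))"
    proof (intro sum.cong refl)
      fix P assume "P \<in> F"
      with snoc.prems(4) have P: "P \<in> permits I K" by auto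
      show "permits_cost I (loc P (ts @ [t])) =
          permits_cost I (loc P ts) + (if P = permit_of t then permits_cost I (B' (ts @ [t])) else 0)"
        unfolding loc_snoc[OF t(1) P] by simp
    qed
    also have "\<dots> = permits_cost I (?pur ts) + permits_cost I (B' (ts @ [t]))"
      using snoc t by (simp add: sum.distrib)
    finally show ?case by (simp add: purchased_snoc)
  qed
  have loc_sub: "set (loc P ts) \<subseteq> set (?pur ts)" if "set ts \<subseteq> days I" "P \<in> permits I K" for P ts
    using that
  proof (induction ts rule: rev_induct)
    case (snoc t ts)
    then have t: "t \<in> days I" by simp
    show ?case
      unfolding loc_snoc[OF t snoc.prems(2)] using snoc by (auto simp: purchased_snoc)
  qed (simp add: loc_Nil)
  have feas: "parking_feasible K (restrict_parking I P) (B P)" if "P \<in> permits I K" for P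
    using B[OF that] by (simp add: parking_competitive_def)
  have "parking_competitive c K I B'"
  proof (rule parking_competitiveI[OF I K c])
    show "parking_feasible K I B'"
    proof (rule parking_feasibleI)
      fix ts p assume ts: "ts \<in> lists (days I)" "ts \<noteq> []" "p \<in> set (B' ts)"
      let ?P = "permit_of (last ts)"
      let ?us = "filter (\<lambda>t. t \<in> ?P) ts"
      have P: "?P \<in> permits I K" "last ts \<in> ?P" using ts(1,2) permit_of[of "last ts"] by auto
      then have "?us \<noteq> []" using ts(2) by (auto simp: filter_empty_conv intro!: bexI[of _ "last ts"])
      then have "\<exists>j<length ?us. take (Suc j) ?us = ?us"
        by (intro exI[of _ "length ?us - 1"]) auto
      then obtain j where j: "j < length ?us" "take (Suc j) ?us = ?us" by blast
      have "p \<in> set (B ?P (take (Suc j) ?us))" using ts(3) j(2) by (simp add: B'_def)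
      from parking_feasibleD(1)[OF feas[OF P(1)] _ j(1) this] show "is_permit K I p" by auto
    next
      fix ts assume "ts \<in> lists (days I)"
      then have ts: "set ts \<subseteq> days I" by auto
      show "set ts \<subseteq> (\<Union>p\<in>set (?pur ts). snd p)"
      proof
        fix t assume t: "t \<in> set ts"
        let ?P = "permit_of t"
        let ?us = "filter (\<lambda>t. t \<in> ?P) ts"
        have P: "?P \<in> permits I K" "t \<in> ?P" using t ts permit_of[of t] by auto
        then have "t \<in> set ?us" using t by simp
        then obtain j where j: "j < length ?us" "?us ! j = t"
          unfolding in_set_conv_nth by blast
        have "t \<in> (\<Union>p\<in>set (purchased (B ?P) ?us (Suc j)). snd p)"
          using parking_feasibleD(2)[OF feas[OF P(1)] _ j(1)] j(2) by auto
        moreover have "set (purchased (B ?P) ?us (Suc j)) \<subseteq> set (loc ?P ts)"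
          unfolding loc_def purchased_def Let_def set_concat set_map
          using j(1) by (intro Union_mono image_mono) auto
        ultimately show "t \<in> (\<Union>p\<in>set (?pur ts). snd p)"
          using loc_sub[OF ts P(1)] by blast
      qed
    qed
    fix ts ps
    assume "ts \<in> lists (days I)" and ps: "\<And>p. p \<in> set ps \<Longrightarrow> is_permit K I p"
      "set ts \<subseteq> (\<Union>p\<in>set ps. snd p)"
    then have ts: "set ts \<subseteq> days I" by auto
    let ?F = "permit_of ` set ts"
    have F: "finite ?F" "?F \<subseteq> permits I K" using ts permit_of by auto
    have "permits_cost I (?pur ts) = (\<Sum>P\<in>?F. permits_cost I (loc P ts))"
      by (rule cost_eq[OF ts _ F]) simp
    also have "\<dots> \<le> (\<Sum>P\<in>?F. c * permits_cost I (filter (\<lambda>p. snd p \<subseteq> P) ps))"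
    proof (rule sum_mono)
      fix P assume "P \<in> ?F"
      then have P: "P \<in> permits I K" using F by auto
      let ?us = "filter (\<lambda>t. t \<in> P) ts"
      let ?ps = "filter (\<lambda>p. snd p \<subseteq> P) ps"
      have "?us \<in> lists (days (restrict_parking I P))" by auto
      with B[OF P] have "permits_cost I (loc P ts) \<le> c * parking_opt K (restrict_parking I P) ?us"
        unfolding parking_competitive_def loc_def Let_def by force
      moreover have "parking_opt K (restrict_parking I P) ?us \<le> permits_cost (restrict_parking I P) ?ps"
      proof (rule parking_opt_le[OF interval_parking_restrict[OF I P K]])
        show "set ?us \<subseteq> (\<Union>p\<in>set ?ps. snd p)"
        proof
          fix t assume t: "t \<in> set ?us"
          then obtain p where p: "p \<in> set ps" "t \<in> snd p" using ps(2) by auto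
          \<comment> \<open>A permit covering a day of \<open>P\<close> lies inside
            \<open>P\<close>, so filtering the offline solution loses no coverage there.\<close>
          then have "snd p \<subseteq> P"
            using ps(1)[OF p(1)] permit_nested[OF I, of "fst p" K "snd p" P t] P t
            by (auto simp: is_permit_def)
          with p show "t \<in> (\<Union>p\<in>set ?ps. snd p)" by (intro UN_I[of p]) auto
        qed
      qed (use ps in auto)
      ultimately show "permits_cost I (loc P ts) \<le> c * permits_cost I ?ps"
        unfolding permits_cost_restrict by (rule order_trans[OF _ mult_left_mono[OF _ c]])
    qed
    also have "\<dots> \<le> c * permits_cost I ps"
      using sum_permits_cost_filter_le[OF I K F ps(1)] c
      by (simp add: sum_distrib_left[symmetric] mult_left_mono)
    finally show "permits_cost I (?pur ts) \<le> c * permits_cost I ps" .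
  qed
  then show ?thesis by blast
qed

theorem theorem3:
  fixes K :: nat and c :: real
  assumes "1 \<le> K"
    and "\<exists>A :: hst \<Rightarrow> real \<Rightarrow> nat sum_radii_alg.
           \<forall>\<alpha> T f. 1 < \<alpha> \<longrightarrow> is_hst \<alpha> K T \<longrightarrow> 0 < f \<longrightarrow>
             sum_radii_competitive c (nodes T) (tree_dist T) f (A T f)"
  shows "\<exists>B :: parking \<Rightarrow> parking_alg.
           \<forall>I. interval_parking K I \<longrightarrow> parking_competitive c K I (B I)"
proof -
  obtain A :: "hst \<Rightarrow> real \<Rightarrow> nat sum_radii_alg" where
    A: "\<And>\<alpha> T f. 1 < \<alpha> \<Longrightarrow> is_hst \<alpha> K T \<Longrightarrow> 0 < f \<Longrightarrow>
      sum_radii_competitive c (nodes T) (tree_dist T) f (A T f)"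
    using assms(2) by blast
  have c: "0 \<le> c"
  proof -
    obtain T where T: "is_hst 2 K T" using ex_hst by blast
    then have "hst_root T \<in> nodes T" by (simp add: is_hst_def complete_rooted_tree_def)
    then show ?thesis
      using sum_radii_competitive_imp_nonneg[OF A[OF _ T, of 1] _ Metric_space_tree_dist[OF T]] by simp
  qed
  have "\<exists>B. parking_competitive c K I B" if I: "interval_parking K I" for I
  proof -
    have "\<exists>B. parking_competitive c K (restrict_parking I P) B" if P: "P \<in> permits I K" for P
    proof -
      \<comment> \<open>Longest permits are nonempty and disjoint, so the restricted instance has
        just one of them, as the locale demands.\<close>
      have "Q = P" if Q: "Q \<in> permits I K" "Q \<subseteq> P" for Q
      proof -
        have "Q \<noteq> {}"
          using partition_onD3[OF interval_parkingD(3)[OF I assms(1)]] Q(1) by auto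
        then show ?thesis
          using permit_eq[OF I assms(1) order_refl Q(1) P] Q(2) by blast
      qed
      then have "{Q \<in> permits I K. Q \<subseteq> P} = {P}" using P by auto
      then interpret rooted_parking K "restrict_parking I P"
        using interval_parking_restrict[OF I P assms(1)] assms(1) by unfold_locales auto
      \<comment> \<open>The ratio \<open>sep\<close> depends on the instance and may be close to 1;
        the assumption on \<open>A\<close> covers every ratio above 1.\<close>
      show ?thesis
        using online_competitive[OF A[OF sep_gt_1 hst_tree cst_pos] c] by blast
    qed
    then have "\<forall>P\<in>permits I K. \<exists>B. parking_competitive c K (restrict_parking I P) B"
      by blast
    from bchoice[OF this] obtain B where
      "\<And>P. P \<in> permits I K \<Longrightarrow> parking_competitive c K (restrict_parking I P) (B P)"
      by blast
    then show ?thesis by (rule parking_competitive_of_restrict[OF I assms(1) c])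
  qed
  then have "\<forall>I. \<exists>B. interval_parking K I \<longrightarrow> parking_competitive c K I B" by blast
  then show ?thesis by (rule choice)
qed

end
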